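(* Let $d:\mathbb Z\times\mathbb Z\to\mathbb R$ be defined by $d(m,n):=\|m-n\|$, where $\|0\|:=0$ and, for $n\in\mathbb Z\setminus\{0\}$, $\|n\|:=\dfrac{1}{\max\{k\in\mathbb N^*: 1\mid n,\ 2\mid n,\ \dots,\ k\mid n\}}$. Then $(\mathbb Z,d)$ is a metric space, and the metric $d$ induces the topology $\mathcal T$ on $\mathbb Z$ (i.e. a subset of $\mathbb Z$ is open with respect to $d$ if and only if it belongs to $\mathcal T$).
   Context: $\mathbb N^*$ denotes the set of positive integers. For $a\in\mathbb Z$ and $b\in\mathbb N^*$, $a+b\mathbb Z:=\{a+bn:n\in\mathbb Z\}$. The topology $\mathcal T$ on $\mathbb Z$ (Fürstenberg's topology) is defined as follows: a set $A\subset\mathbb Z$ is open (belongs to $\mathcal T$) if, for each $a\in A$, there is $b\in\mathbb N^*$ such that $a+b\mathbb Z\subset A$. *)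

theory Defs
  imports "HOL-Analysis.Abstract_Metric_Spaces"
begin

definition arith_prog :: "int \<Rightarrow> int \<Rightarrow> int set" where
  "arith_prog a b = {a + b * n | n. True}"

definition furstenberg_open :: "int set \<Rightarrow> bool" where
  "furstenberg_open A \<longleftrightarrow> (\<forall>a\<in>A. \<exists>b>0. arith_prog a b \<subseteq> A)"

definition furstenberg_topology :: "int topology" where
  "furstenberg_topology = topology furstenberg_open"

lemma istopology_furstenberg_open: "istopology furstenberg_open"
  unfolding istopology_def
proof (intro conjI allI impI)
  fix S T
  assume S: "furstenberg_open S" and T: "furstenberg_open T"
  show "furstenberg_open (S \<inter> T)"
    unfolding furstenberg_open_def
  proof
    fix a
    assume a: "a \<in> S \<inter> T"
    obtain b where b: "b > 0" "arith_prog a b \<subseteq> S"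
      using S a unfolding furstenberg_open_def by blast
    obtain c where c: "c > 0" "arith_prog a c \<subseteq> T"
      using T a unfolding furstenberg_open_def by blast
    have "arith_prog a (b * c) \<subseteq> arith_prog a b" "arith_prog a (b * c) \<subseteq> arith_prog a c"
      unfolding arith_prog_def by (auto simp: mult.assoc)
    then show "\<exists>b>0. arith_prog a b \<subseteq> S \<inter> T"
      using b c by (intro exI[of _ "b * c"]) auto
  qed
next
  fix K
  assume "\<forall>S\<in>K. furstenberg_open S"
  then show "furstenberg_open (\<Union>K)"
    unfolding furstenberg_open_def by (meson UnionE Union_upper order_trans)
qed

lemma openin_furstenberg_topology: "openin furstenberg_topology A \<longleftrightarrow> furstenberg_open A"
  unfolding furstenberg_topology_def
  by (simp add: topology_inverse' istopology_furstenberg_open)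

(* For n = 0 the set under Max would be infinite, hence the separate case. *)
definition furstenberg_norm :: "int \<Rightarrow> real" where
  "furstenberg_norm n =
     (if n = 0 then 0 else 1 / real (Max {k::nat. k > 0 \<and> (\<forall>j\<in>{1..k}. int j dvd n)}))"

definition furstenberg_dist :: "int \<Rightarrow> int \<Rightarrow> real" where
  "furstenberg_dist m n = furstenberg_norm (m - n)"

end

(* The norm satisfies furstenberg_norm n \<le> 1 / k iff n is divisible by 1, ..., k.
   These n form a subgroup, so the norm is an ultrametric one.  The ball of radius 1 / b at a lies
   in a + b\<int>, and conversely a + k!\<int> lies in every ball at a of radius greater than 1 / k. *)

theory Submission
  imports Defs
begin

text \<open>Every member \<open>k\<close> divides \<open>n\<close> itself, hence is at most
  \<bar>n\<bar>. Finiteness is what gives \<open>Max\<close> in the norm its intended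
  meaning.\<close>

lemma finite_initial_divisors:
  fixes n :: int
  assumes "n \<noteq> 0"
  shows "finite {k::nat. k > 0 \<and> (\<forall>j\<in>{1..k}. int j dvd n)}"
proof (rule finite_subset)
  show "{k::nat. k > 0 \<and> (\<forall>j\<in>{1..k}. int j dvd n)} \<subseteq> {..nat \<bar>n\<bar>}"
  proof
    fix k
    assume "k \<in> {k::nat. k > 0 \<and> (\<forall>j\<in>{1..k}. int j dvd n)}"
    then have "k \<in> {1..k}" "\<forall>j\<in>{1..k}. int j dvd n" by simp_all
    then have "int k dvd n" by blast
    with assms have "int k \<le> \<bar>n\<bar>" using dvd_imp_le_int[of n "int k"] by simp
    then show "k \<in> {..nat \<bar>n\<bar>}" by simp
  qed
qed simp

text \<open>Since 1 lies in the set, the maximum is attained and positive. This form serves to show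
  that the norm vanishes only at 0 and to compare two norms.\<close>

lemma furstenberg_norm_eq_inverse_nat:
  assumes "n \<noteq> 0"
  obtains k where "k > 0" "furstenberg_norm n = 1 / real k"
proof -
  let ?S = "{k::nat. k > 0 \<and> (\<forall>j\<in>{1..k}. int j dvd n)}"
  have "1 \<in> ?S" by simp
  then have "Max ?S \<in> ?S"
    using Max_in[OF finite_initial_divisors[OF assms]] by blast
  then have "Max ?S > 0" by blast
  then show thesis
    using that assms unfolding furstenberg_norm_def by presburger
qed

text \<open>The set under \<open>Max\<close> is an initial segment of the positive integers, so
  \<open>k\<close> is at most its maximum exactly when \<open>k\<close> is a member. For
  \<open>n = 0\<close> both sides hold. Later bounds on the norm thus become divisibility statements
  free of \<open>Max\<close>.\<close>

lemma furstenberg_norm_le_iff: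
  assumes "k > 0"
  shows "furstenberg_norm n \<le> 1 / real k \<longleftrightarrow> (\<forall>j\<in>{1..k}. int j dvd n)"
proof (cases "n = 0")
  case True
  then show ?thesis by (simp add: furstenberg_norm_def)
next
  case False
  let ?S = "{k::nat. k > 0 \<and> (\<forall>j\<in>{1..k}. int j dvd n)}"
  have fin: "finite ?S" using False by (rule finite_initial_divisors)
  have "1 \<in> ?S" by simp
  then have M: "Max ?S \<in> ?S"
    using Max_in[OF fin] by blast
  then have pos: "Max ?S > 0" by blast
  have "furstenberg_norm n \<le> 1 / real k \<longleftrightarrow> k \<le> Max ?S"
    using False assms pos by (simp add: furstenberg_norm_def field_simps)
  also have "\<dots> \<longleftrightarrow> k \<in> ?S"
  proof
    assume "k \<le> Max ?S"
    moreover have "\<forall>j\<in>{1..Max ?S}. int j dvd n" using M by blast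
    ultimately have "\<forall>j\<in>{1..k}. int j dvd n" by (meson atLeastAtMost_iff order_trans)
    with assms show "k \<in> ?S" by blast
  qed (use fin in simp)
  finally show ?thesis using assms by simp
qed

lemma furstenberg_norm_nonneg: "0 \<le> furstenberg_norm n"
  by (simp add: furstenberg_norm_def)

lemma furstenberg_norm_eq_0_iff: "furstenberg_norm n = 0 \<longleftrightarrow> n = 0"
proof (cases "n = 0")
  case False
  then obtain k where "k > 0" "furstenberg_norm n = 1 / real k"
    by (rule furstenberg_norm_eq_inverse_nat)
  with False show ?thesis by simp
qed (simp add: furstenberg_norm_def)

lemma furstenberg_norm_minus: "furstenberg_norm (- n) = furstenberg_norm n"
  by (simp add: furstenberg_norm_def)

text \<open>Common divisors of two integers divide their sum. If the norms are 1/k and 1/l, the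
  larger one is 1/min(k, l), and both integers are divisible by 1, ..., min(k, l).\<close>

lemma furstenberg_norm_ultrametric:
  "furstenberg_norm (m + n) \<le> max (furstenberg_norm m) (furstenberg_norm n)"
\<comment> \<open>The norm of 0 is not the reciprocal of a positive integer; here the sum is simply
  the other argument.\<close>
proof (cases "m = 0 \<or> n = 0")
  case True
  then show ?thesis by auto
next
  case False
  then obtain k l where k: "k > 0" "furstenberg_norm m = 1 / real k"
    and l: "l > 0" "furstenberg_norm n = 1 / real l"
    by (meson furstenberg_norm_eq_inverse_nat)
  have "furstenberg_norm m \<le> 1 / real (min k l)" "furstenberg_norm n \<le> 1 / real (min k l)"
    using k l by (auto simp: frac_le)
  then have "furstenberg_norm (m + n) \<le> 1 / real (min k l)"
    using k(1) l(1) by (auto simp: furstenberg_norm_le_iff intro!: dvd_add)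
  then show ?thesis using k l by (auto simp: min_def max_def split: if_splits)
qed

lemma Metric_space_furstenberg_dist: "Metric_space UNIV furstenberg_dist"
proof
  fix x y z :: int
  show "0 \<le> furstenberg_dist x y"
    by (simp add: furstenberg_dist_def furstenberg_norm_nonneg)
  show "furstenberg_dist x y = furstenberg_dist y x"
    using furstenberg_norm_minus[of "x - y"] by (simp add: furstenberg_dist_def)
  show "furstenberg_dist x y = 0 \<longleftrightarrow> x = y"
    by (simp add: furstenberg_dist_def furstenberg_norm_eq_0_iff)
  \<comment> \<open>The differences x - y and y - z add up to x - z, and the maximum of two
    nonnegative numbers is at most their sum.\<close>
  show "furstenberg_dist x z \<le> furstenberg_dist x y + furstenberg_dist y z"
    using furstenberg_norm_ultrametric[of "x - y" "y - z"]
      furstenberg_norm_nonneg[of "x - y"] furstenberg_norm_nonneg[of "y - z"]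
    by (simp add: furstenberg_dist_def)
qed

interpretation furstenberg: Metric_space UNIV furstenberg_dist
  by (rule Metric_space_furstenberg_dist)

lemma mball_subset_arith_prog:
  assumes "b > 0"
  shows "furstenberg.mball a (1 / real_of_int b) \<subseteq> arith_prog a b"
proof
  fix x
  assume "x \<in> furstenberg.mball a (1 / real_of_int b)"
  \<comment> \<open>The strict bound is weakened and \<open>b\<close> is read as a natural number to
    match \<open>furstenberg_norm_le_iff\<close>; of the resulting divisors only \<open>b\<close>
    itself is used.\<close>
  then have "furstenberg_norm (a - x) \<le> 1 / real (nat b)"
    using assms by (simp add: furstenberg_dist_def)
  then have "\<forall>j\<in>{1..nat b}. int j dvd a - x"
    using assms by (subst (asm) furstenberg_norm_le_iff) auto
  moreover have "nat b \<in> {1..nat b}" using assms by auto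
  ultimately have "int (nat b) dvd a - x" by blast
  then have "b dvd x - a" using assms by (simp add: dvd_diff_commute)
  then obtain n where "x - a = b * n" ..
  then have "x = a + b * n" by simp
  then show "x \<in> arith_prog a b" unfolding arith_prog_def by blast
qed

text \<open>Each of 1, ..., k divides k!, so all differences from \<open>a\<close> have norm at most
  1/k, which is strictly below the radius of the open ball.\<close>

lemma arith_prog_fact_subset_mball:
  assumes "k > 0" "1 / real k < r"
  shows "arith_prog a (fact k) \<subseteq> furstenberg.mball a r"
proof
  fix x
  assume "x \<in> arith_prog a (fact k)"
  then obtain n where x: "x = a + fact k * n" unfolding arith_prog_def by blast
  have "int j dvd a - x" if "j \<in> {1..k}" for j
  proof -
    have "j dvd fact k" using that by (intro dvd_fact) auto
    then have "int j dvd int (fact k)" by (simp only: int_dvd_int_iff)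
    then have "int j dvd fact k" by (simp only: of_nat_fact)
    then have "int j dvd fact k * (- n)" by (rule dvd_mult2)
    moreover have "a - x = fact k * (- n)" by (simp add: x)
    ultimately show ?thesis by (simp only:)
  qed
  then have "furstenberg_norm (a - x) \<le> 1 / real k"
    using assms(1) by (simp add: furstenberg_norm_le_iff)
  with assms(2) show "x \<in> furstenberg.mball a r"
    by (simp add: furstenberg_dist_def)
qed

lemma mtopology_furstenberg_dist: "furstenberg.mtopology = furstenberg_topology"
proof (rule topology_eq[THEN iffD2], intro allI)
  fix U
  \<comment> \<open>In both topologies openness is tested point by point, so it suffices that balls
    and progressions at \<open>a\<close> can be nested in each other.\<close>
  have "(\<exists>r>0. furstenberg.mball a r \<subseteq> U) \<longleftrightarrow> (\<exists>b>0. arith_prog a b \<subseteq> U)" for a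
  proof
    assume "\<exists>r>0. furstenberg.mball a r \<subseteq> U"
    then obtain r where r: "r > 0" "furstenberg.mball a r \<subseteq> U" by blast
    obtain k where "k > 0" "1 / real k < r"
      using ex_inverse_of_nat_less[OF r(1)] by (auto simp: inverse_eq_divide)
    then have "arith_prog a (fact k) \<subseteq> U"
      using arith_prog_fact_subset_mball r(2) by blast
    then show "\<exists>b>0. arith_prog a b \<subseteq> U" by (intro exI[of _ "fact k"]) simp
  next
    assume "\<exists>b>0. arith_prog a b \<subseteq> U"
    then obtain b where b: "b > 0" "arith_prog a b \<subseteq> U" by blast
    then have "furstenberg.mball a (1 / real_of_int b) \<subseteq> U"
      using mball_subset_arith_prog by blast
    moreover have "1 / real_of_int b > 0" using b(1) by simp
    ultimately show "\<exists>r>0. furstenberg.mball a r \<subseteq> U" by blast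
  qed
  then show "openin furstenberg.mtopology U \<longleftrightarrow> openin furstenberg_topology U"
    by (simp add: furstenberg.openin_mtopology openin_furstenberg_topology
        furstenberg_open_def Ball_def)
qed

theorem theorem1:
  "Metric_space (UNIV :: int set) furstenberg_dist \<and>
   Metric_space.mtopology (UNIV :: int set) furstenberg_dist = furstenberg_topology"
  using Metric_space_furstenberg_dist mtopology_furstenberg_dist by blast

end
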